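(* Let $\ell_{\mathrm{LS}}(d,c):=\|d-c\|_2^2$ be the squared loss, let $\mathcal{P}$ be the class of distributions $\mathbb{P}$ on $W\times C$ such that for all $w\in W$ the conditional distribution $\mathbb{P}[\cdot\mid w]$ of $c$ is square integrable and $\mathbb{E}[c\mid w]\in\operatorname{Conv}(C)$, and assume $B_C:=\max_{c\in C}\|c\|_2<\infty$. Then for every $\mathbb{P}\in\mathcal{P}$ and every (measurable) $g:W\to\mathbb{R}^m$, $$\frac{1}{B_X^2}\left(R(g,\mathbb{P})-R(\mathbb{P})\right)^2\le R_{\ell_{\mathrm{LS}}}(g,\mathbb{P})-R_{\ell_{\mathrm{LS}}}(\mathbb{P}).$$
   Context: Setting: $X\subset\mathbb{R}^m$ is a non-empty convex compact set with Euclidean diameter $B_X:=\max_{x,x'\in X}\|x-x'\|_2$; $f:X\to\mathbb{R}$ is convex and continuous; $W\subseteq\mathbb{R}^k$ and $C\subseteq\mathbb{R}^m$ are given sets. For $d\in\mathbb{R}^m$, $X^*(d):=\operatorname{argmin}_{x\in X}\{f(x)+d^\top x\}$, and $x^*:\mathbb{R}^m\to X$ is a fixed function with $x^*(d)\in X^*(d)$ for all $d$ (any such selection is Lebesgue measurable). The true loss is $L(d,c):=f(x^*(d))+c^\top x^*(d)-\min_{x\in X}\{f(x)+c^\top x\}$. Probability distributions $\mathbb{P}$ on $W\times C$ are defined on the $\sigma$-algebra of Lebesgue measurable sets; measurability is in the sense of Lebesgue; $(w,c)\sim\mathbb{P}$, and $\mathbb{E}[\cdot\mid w]$ is conditional expectation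 given $w$. For measurable $g:W\to\mathbb{R}^m$: $R(g,\mathbb{P}):=\mathbb{E}[L(g(w),c)]$, $R(\mathbb{P}):=\inf_g R(g,\mathbb{P})$, and for a loss $\ell$, $R_\ell(g,\mathbb{P}):=\mathbb{E}[\ell(g(w),c)]$, $R_\ell(\mathbb{P}):=\inf_g R_\ell(g,\mathbb{P})$; infima are over measurable $g:W\to\mathbb{R}^m$.
   Formalization: The claim, and the infimum R(P), range over measurable g for which x*(g(w)) is also Lebesgue measurable in w; for other measurable g the expectation R(g,P) can be undefined, since a composition of Lebesgue measurable maps need not be measurable. *)

theory Defs
  imports "HOL-Probability.Probability"
begin

definition argmin_set :: "('m::euclidean_space) set \<Rightarrow> ('m \<Rightarrow> real) \<Rightarrow> 'm \<Rightarrow> 'm set" where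
  "argmin_set X f d = {x. is_arg_min (\<lambda>x. f x + d \<bullet> x) (\<lambda>x. x \<in> X) x}"

(* For compact nonempty X and continuous f the infimum is attained, so it is a minimum. *)
definition true_loss ::
    "('m::euclidean_space) set \<Rightarrow> ('m \<Rightarrow> real) \<Rightarrow> ('m \<Rightarrow> 'm) \<Rightarrow> 'm \<Rightarrow> 'm \<Rightarrow> real" where
  "true_loss X f xs d c = f (xs d) + c \<bullet> xs d - (INF x\<in>X. f x + c \<bullet> x)"

definition squared_loss :: "'m::euclidean_space \<Rightarrow> 'm \<Rightarrow> real" where
  "squared_loss d c = (norm (d - c))\<^sup>2"

(* The expectation of l (g w) c for a nonnegative loss l. It may be infinite, hence the
   extended reals; a Bochner integral would return 0 in that case. *)
definition risk ::
    "('m \<Rightarrow> 'm \<Rightarrow> real) \<Rightarrow> ('k \<times> 'm) measure \<Rightarrow> ('k \<Rightarrow> 'm) \<Rightarrow> ereal" where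
  "risk l P g = enn2ereal (\<integral>\<^sup>+ z. ennreal (l (g (fst z)) (snd z)) \<partial>P)"

definition min_risk ::
    "('m \<Rightarrow> 'm \<Rightarrow> real) \<Rightarrow> ('k \<times> 'm) measure \<Rightarrow> ('k \<Rightarrow> 'm) set \<Rightarrow> ereal" where
  "min_risk l P G = (INF g\<in>G. risk l P g)"

abbreviation predictors ::
    "('k::euclidean_space) set \<Rightarrow> ('k \<Rightarrow> 'm::euclidean_space) set" where
  "predictors W \<equiv> borel_measurable (lebesgue_on W)"

(* The measurable predictors g whose induced decision xs (g w) is measurable in w, that is,
   those for which the expected true loss makes sense. A selection xs from the argmin sets
   is arbitrary on the null set of those d with several minimizers, and g may take its values
   in that null set, so this does not follow from measurability of g. It is automatic for
   Borel xs, see decision_predictors_eq. *)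
definition decision_predictors ::
    "('k::euclidean_space) set \<Rightarrow> ('m \<Rightarrow> 'm) \<Rightarrow> ('k \<Rightarrow> 'm::euclidean_space) set" where
  "decision_predictors W xs = {g \<in> predictors W. (\<lambda>w. xs (g w)) \<in> borel_measurable (lebesgue_on W)}"

lemma decision_predictors_eq:
  assumes "xs \<in> borel_measurable borel"
  shows "decision_predictors W xs = predictors W"
  unfolding decision_predictors_def using measurable_compose[OF _ assms] by blast

(* Probability measures on the Lebesgue measurable subsets of W \<times> C (trace sigma-algebra if
   W \<times> C is not itself measurable). *)
definition distributions ::
    "('k::euclidean_space) set \<Rightarrow> ('m::euclidean_space) set \<Rightarrow> ('k \<times> 'm) measure set" where
  "distributions W C = {P. prob_space P \<and> sets P = sets (lebesgue_on (W \<times> C))}"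

(* K is a regular conditional distribution of c given w; the outer integral is with respect
   to the marginal distribution of w. *)
definition conditional_distribution ::
    "('k::euclidean_space) set \<Rightarrow> ('m::euclidean_space) set \<Rightarrow> ('k \<times> 'm) measure
      \<Rightarrow> ('k \<Rightarrow> 'm measure) \<Rightarrow> bool" where
  "conditional_distribution W C P K \<longleftrightarrow>
     K \<in> lebesgue_on W \<rightarrow>\<^sub>M prob_algebra (lebesgue_on C) \<and>
     (\<forall>A\<in>sets (lebesgue_on W). \<forall>B\<in>sets (lebesgue_on C).
        emeasure P (A \<times> B) = (\<integral>\<^sup>+ w\<in>A. emeasure (K w) B \<partial>distr P (lebesgue_on W) fst))"

(* Conditional distributions are determined only up to null sets of w, so the pointwise
   conditions are imposed on some version. *)
definition distribution_class ::
    "('k::euclidean_space) set \<Rightarrow> ('m::euclidean_space) set \<Rightarrow> ('k \<times> 'm) measure set" where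
  "distribution_class W C = {P \<in> distributions W C.
     \<exists>K. conditional_distribution W C P K \<and>
       (\<forall>w\<in>W. integrable (K w) (\<lambda>c. (norm c)\<^sup>2) \<and> (\<integral>c. c \<partial>K w) \<in> convex hull C)}"

end

theory Submission
  imports Defs
begin

text \<open>Write \<open>m w\<close> for the conditional mean of \<open>c\<close> given \<open>w\<close> and \<open>V c\<close> for the optimal value at cost
  \<open>c\<close>. The decision cost is linear in \<open>c\<close>, so the true risk of \<open>g\<close> is the expectation of
  \<open>L (g w) (m w)\<close> plus the constant \<open>E (V (m w) - V c)\<close>, which is therefore a lower bound on the
  minimal true risk. Optimality of the decisions gives the pointwise regret bound
  \<open>L d c \<le> diameter X * norm (d - c)\<close>, and Jensen's inequality bounds the squared excess true risk
  by \<open>(diameter X)\<^sup>2\<close> times the expectation of the squared norm of \<open>g w - m w\<close>. By Pythagoras this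
  expectation is the excess of the squared risk of \<open>g\<close> over that of \<open>m\<close>.\<close>

section \<open>Projections and the Lebesgue sigma-algebras\<close>

text \<open>The Lebesgue sigma-algebra of a product contains more than the product sigma-algebra, so
  the usual rule for projections does not apply directly. A Lebesgue set is a Borel set
  \<open>S\<close> together with a part \<open>N\<close> of a Borel null set \<open>N'\<close>. Its
  preimage has the same shape, because \<open>N' \<times> UNIV\<close> is again null.\<close>

lemma fst_measurable_lebesgue:
  "fst \<in> (lebesgue :: ('a::euclidean_space \<times> 'b::euclidean_space) measure) \<rightarrow>\<^sub>M lebesgue"
proof (rule measurableI)
  fix A :: "'a set"
  assume "A \<in> sets lebesgue"
  then obtain S N N' where A: "A = S \<union> N" "N \<subseteq> N'" "S \<in> sets lborel" "N' \<in> null_sets lborel"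
    by (rule sets_completionE)
  have "N' \<times> UNIV \<in> null_sets (lborel \<Otimes>\<^sub>M (lborel :: 'b measure))"
    using A(4) by (intro lborel.times_in_null_sets1) auto
  then have "N' \<times> UNIV \<in> null_sets (lborel :: ('a \<times> 'b) measure)"
    by (simp only: lborel_prod)
  moreover have "S \<times> UNIV \<in> sets (lborel \<Otimes>\<^sub>M (lborel :: 'b measure))"
    using A(3) by auto
  then have "S \<times> UNIV \<in> sets (lborel :: ('a \<times> 'b) measure)"
    by (simp only: lborel_prod)
  ultimately have "S \<times> UNIV \<union> N \<times> UNIV \<in> sets (lebesgue :: ('a \<times> 'b) measure)"
    using A(2) by (intro sets_completionI) auto
  moreover have "fst -` A \<inter> space lebesgue = S \<times> UNIV \<union> N \<times> (UNIV :: 'b set)"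
    using A(1) by auto
  ultimately show "fst -` A \<inter> space (lebesgue :: ('a \<times> 'b) measure) \<in> sets lebesgue"
    by simp
qed simp

lemma snd_measurable_lebesgue:
  "snd \<in> (lebesgue :: ('a::euclidean_space \<times> 'b::euclidean_space) measure) \<rightarrow>\<^sub>M lebesgue"
proof (rule measurableI)
  fix A :: "'b set"
  assume "A \<in> sets lebesgue"
  then obtain S N N' where A: "A = S \<union> N" "N \<subseteq> N'" "S \<in> sets lborel" "N' \<in> null_sets lborel"
    by (rule sets_completionE)
  have "UNIV \<times> N' \<in> null_sets ((lborel :: 'a measure) \<Otimes>\<^sub>M lborel)"
    using A(4) by (intro lborel.times_in_null_sets2) auto
  then have "UNIV \<times> N' \<in> null_sets (lborel :: ('a \<times> 'b) measure)"
    by (simp only: lborel_prod)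
  moreover have "UNIV \<times> S \<in> sets ((lborel :: 'a measure) \<Otimes>\<^sub>M lborel)"
    using A(3) by auto
  then have "UNIV \<times> S \<in> sets (lborel :: ('a \<times> 'b) measure)"
    by (simp only: lborel_prod)
  ultimately have "UNIV \<times> S \<union> UNIV \<times> N \<in> sets (lebesgue :: ('a \<times> 'b) measure)"
    using A(2) by (intro sets_completionI) auto
  moreover have "snd -` A \<inter> space lebesgue = UNIV \<times> S \<union> (UNIV :: 'a set) \<times> N"
    using A(1) by auto
  ultimately show "snd -` A \<inter> space (lebesgue :: ('a \<times> 'b) measure) \<in> sets lebesgue"
    by simp
qed simp

lemma fst_measurable_lebesgue_on:
  "fst \<in> lebesgue_on (W \<times> C) \<rightarrow>\<^sub>M lebesgue_on W"
  for W :: "'a::euclidean_space set" and C :: "'b::euclidean_space set"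
  by (rule measurable_restrict_space2)
     (auto simp: space_restrict_space intro: measurable_restrict_space1 fst_measurable_lebesgue)

lemma snd_measurable_lebesgue_on:
  "snd \<in> lebesgue_on (W \<times> C) \<rightarrow>\<^sub>M lebesgue_on C"
  for W :: "'a::euclidean_space set" and C :: "'b::euclidean_space set"
  by (rule measurable_restrict_space2)
     (auto simp: space_restrict_space intro: measurable_restrict_space1 snd_measurable_lebesgue)

section \<open>Deterministic bounds for decisions that minimize a linearly perturbed
  objective\<close>

locale argmin_oracle =
  fixes X :: "'m::euclidean_space set" and f :: "'m \<Rightarrow> real" and xs :: "'m \<Rightarrow> 'm"
  assumes argmin: "\<And>d. xs d \<in> argmin_set X f d"
    and compact_feasible: "compact X"
    and continuous_objective: "continuous_on X f"
begin

lemma bounded_feasible: "bounded X"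
  by (rule compact_imp_bounded[OF compact_feasible])

definition opt_value :: "'m \<Rightarrow> real" where
  "opt_value c = (INF x\<in>X. f x + c \<bullet> x)"

lemma xs_feasible: "xs d \<in> X"
  using argmin[of d] by (auto simp: argmin_set_def is_arg_min_def)

lemma xs_minimal: "x \<in> X \<Longrightarrow> f (xs d) + d \<bullet> xs d \<le> f x + d \<bullet> x"
  using argmin[of d] by (force simp: argmin_set_def is_arg_min_linorder)

lemma opt_value_eq: "opt_value c = f (xs c) + c \<bullet> xs c"
  unfolding opt_value_def
  by (rule cInf_eq_minimum) (auto intro: xs_feasible xs_minimal)

lemma opt_value_le: "x \<in> X \<Longrightarrow> opt_value c \<le> f x + c \<bullet> x"
  by (simp add: opt_value_eq xs_minimal)

lemma true_loss_eq: "true_loss X f xs d c = f (xs d) + c \<bullet> xs d - opt_value c"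
  by (simp add: true_loss_def opt_value_def)

lemma true_loss_nonneg: "0 \<le> true_loss X f xs d c"
  using opt_value_le[OF xs_feasible, of c d] by (simp add: true_loss_eq)

text \<open>Optimality of \<open>xs d\<close> at cost \<open>d\<close>, tested against
  \<open>xs c\<close>, bounds the difference of the \<open>f\<close> values by an inner product with
  \<open>d\<close>. The loss is then at most \<open>(d - c) \<bullet> (xs c - xs d)\<close>, to
  which Cauchy-Schwarz applies.\<close>

lemma true_loss_le: "true_loss X f xs d c \<le> diameter X * norm (d - c)"
proof -
  have "true_loss X f xs d c \<le> (d - c) \<bullet> (xs c - xs d)"
    using xs_minimal[OF xs_feasible, of d c]
    by (simp add: true_loss_eq opt_value_eq algebra_simps)
  also have "\<dots> \<le> norm (d - c) * norm (xs c - xs d)"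
    by (rule norm_cauchy_schwarz)
  also have "\<dots> \<le> norm (d - c) * diameter X"
    using diameter_bounded_bound[OF bounded_feasible xs_feasible xs_feasible, of c d]
    by (intro mult_left_mono) (auto simp: dist_norm)
  finally show ?thesis by (simp add: mult.commute)
qed

text \<open>A minimum of affine functions of \<open>c\<close> whose slopes lie in the bounded set
  \<open>X\<close> is Lipschitz. The argument asks for no measurability of
  \<open>xs\<close>.\<close>

lemma opt_value_measurable: "opt_value \<in> borel_measurable borel"
proof -
  obtain b where b: "\<And>x. x \<in> X \<Longrightarrow> norm x \<le> b" and "0 < b"
    using bounded_feasible by (meson bounded_pos)
  have le: "opt_value c \<le> opt_value d + b * norm (c - d)" for c d
  proof -
    have "opt_value c \<le> opt_value d + (c - d) \<bullet> xs d"
      using opt_value_le[OF xs_feasible, of c d] by (simp add: opt_value_eq[of d] algebra_simps)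
    also have "(c - d) \<bullet> xs d \<le> norm (c - d) * norm (xs d)"
      by (rule norm_cauchy_schwarz)
    also have "\<dots> \<le> norm (c - d) * b"
      by (intro mult_left_mono b xs_feasible) auto
    finally show ?thesis by (simp add: mult.commute)
  qed
  have "b-lipschitz_on UNIV opt_value"
  proof (rule lipschitz_onI)
    show "dist (opt_value c) (opt_value d) \<le> b * dist c d" for c d
      using le[of c d] le[of d c] by (auto simp: dist_norm norm_minus_commute)
  qed (use \<open>0 < b\<close> in simp)
  then show ?thesis
    by (intro borel_measurable_continuous_onI lipschitz_on_continuous_on)
qed

text \<open>Continuity of \<open>f\<close> is known on \<open>X\<close> only, so the composition
  passes through the trace of the Borel sets on \<open>X\<close>, where all decisions lie.\<close>

lemma objective_measurable:
  assumes "(\<lambda>w. xs (h w)) \<in> borel_measurable M"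
  shows "(\<lambda>w. f (xs (h w))) \<in> borel_measurable M"
proof (rule measurable_compose[of "\<lambda>w. xs (h w)" M "restrict_space borel X" f])
  show "(\<lambda>w. xs (h w)) \<in> M \<rightarrow>\<^sub>M restrict_space borel X"
    using assms xs_feasible by (intro measurable_restrict_space2) auto
  show "f \<in> borel_measurable (restrict_space borel X)"
    using continuous_objective by (rule borel_measurable_continuous_on_restrict)
qed

text \<open>The bound is uniform in \<open>d\<close>; together with boundedness of \<open>C\<close>
  it makes the true loss integrable for every predictor with measurable decisions.\<close>

lemma cost_bounded:
  obtains B where "\<And>d c. norm c \<le> b \<Longrightarrow> \<bar>f (xs d) + c \<bullet> xs d\<bar> \<le> B"
proof -
  obtain B1 where B1: "\<And>x. x \<in> X \<Longrightarrow> norm x \<le> B1"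
    using bounded_feasible by (auto simp: bounded_iff)
  obtain B2 where B2: "\<And>x. x \<in> X \<Longrightarrow> \<bar>f x\<bar> \<le> B2"
    using compact_imp_bounded[OF compact_continuous_image[OF continuous_objective compact_feasible]]
    by (auto simp: bounded_iff)
  show thesis
  proof (rule that)
    fix d c :: 'm
    assume c: "norm c \<le> b"
    have "\<bar>c \<bullet> xs d\<bar> \<le> norm c * norm (xs d)"
      by (rule Cauchy_Schwarz_ineq2)
    also have "\<dots> \<le> b * B1"
      using c order_trans[OF norm_ge_zero c] by (intro mult_mono B1 xs_feasible) auto
    finally show "\<bar>f (xs d) + c \<bullet> xs d\<bar> \<le> B2 + b * B1"
      using B2[OF xs_feasible, of d] by linarith
  qed
qed

end

section \<open>Conditional means from a kernel\<close>

text \<open>Only the values on rectangles and the measurability of the projections tie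
  \<open>P\<close> to the kernel. Thus \<open>sets P\<close> may exceed the product sigma-algebra,
  as it can for Lebesgue measurable subsets of a product.\<close>

locale disintegration = prob_space P
  for P :: "('a \<times> 'm::euclidean_space) measure" +
  fixes M :: "'a measure" and N :: "'m measure" and K :: "'a \<Rightarrow> 'm measure" and b :: real
  assumes space_eq: "space P = space M \<times> space N"
    and fst_measurable [measurable]: "fst \<in> P \<rightarrow>\<^sub>M M"
    and snd_measurable [measurable]: "snd \<in> P \<rightarrow>\<^sub>M N"
    and kernel: "K \<in> M \<rightarrow>\<^sub>M prob_algebra N"
    and emeasure_Times: "\<And>A B. A \<in> sets M \<Longrightarrow> B \<in> sets N \<Longrightarrow>
      emeasure P (A \<times> B) = (\<integral>\<^sup>+ w\<in>A. emeasure (K w) B \<partial>distr P M fst)"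
    and id_measurable [measurable]: "(\<lambda>c. c) \<in> borel_measurable N"
    and norm_le: "\<And>c. c \<in> space N \<Longrightarrow> norm c \<le> b"
begin

definition cmean :: "'a \<Rightarrow> 'm" where
  "cmean w = (\<integral>c. c \<partial>K w)"

lemma kernel_subprob [measurable]: "K \<in> M \<rightarrow>\<^sub>M subprob_algebra N"
  by (rule measurable_prob_algebraD[OF kernel])

lemma cmean_measurable [measurable]: "cmean \<in> borel_measurable M"
  unfolding cmean_def by measurable

lemma snd_borel_measurable [measurable]: "snd \<in> borel_measurable P"
  using measurable_compose[OF snd_measurable id_measurable] by simp

lemma kernel_space:
  assumes "w \<in> space M"
  shows "prob_space (K w)" "sets (K w) = sets N" "space (K w) = space N"
  using measurable_space[OF kernel assms] sets_eq_imp_space_eq[of "K w" N]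
  by (auto simp: space_prob_algebra)

lemma kernel_integrable:
  assumes "w \<in> space M"
  shows "integrable (K w) (\<lambda>c. c)"
proof -
  interpret Kw: prob_space "K w" using kernel_space[OF assms] by simp
  have "(\<lambda>c. c) \<in> borel_measurable (K w)"
    using id_measurable by (simp add: measurable_cong_sets[OF kernel_space(2)[OF assms] refl])
  then show ?thesis
    by (intro Kw.integrable_const_bound[of _ b])
       (auto simp: kernel_space[OF assms] norm_le intro!: AE_I2)
qed

lemma norm_cmean_le:
  assumes "w \<in> space M"
  shows "norm (cmean w) \<le> b"
proof -
  interpret Kw: prob_space "K w" using kernel_space[OF assms] by simp
  have "norm (cmean w) \<le> (\<integral>c. norm c \<partial>K w)"
    unfolding cmean_def by (rule integral_norm_bound)
  also have "\<dots> \<le> (\<integral>c. b \<partial>K w)"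
    using kernel_integrable[OF assms] kernel_space[OF assms] norm_le
    by (intro integral_mono) auto
  finally show ?thesis by (simp add: Kw.prob_space)
qed

text \<open>For fixed \<open>A\<close> both sides integrate \<open>v\<close> against a measure on
  \<open>N\<close>: the law of \<open>snd\<close> under \<open>P\<close> restricted to
  \<open>fst\<close> in \<open>A\<close>, and the restricted marginal bound to \<open>K\<close>. The
  rectangle formula says that these two measures coincide.\<close>

lemma nn_integral_disintegration:
  assumes [measurable]: "A \<in> sets M" and v [measurable]: "v \<in> borel_measurable N"
  shows "(\<integral>\<^sup>+ z. indicator A (fst z) * v (snd z) \<partial>P)
    = (\<integral>\<^sup>+ z. indicator A (fst z) * (\<integral>\<^sup>+ c. v c \<partial>K (fst z)) \<partial>P)"
proof -
  let ?Q = "distr (density P (\<lambda>z. indicator A (fst z))) N snd"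
  let ?R = "density (distr P M fst) (indicator A) \<bind> K"
  \<comment> \<open>On an empty space \<open>bind\<close> takes a default value, so its rules ask
    for a nonempty one.\<close>
  have nonempty: "space M \<noteq> {}"
    using not_empty space_eq by auto
  have K: "K \<in> density (distr P M fst) (indicator A) \<rightarrow>\<^sub>M subprob_algebra N"
    by simp
  have sets_R: "sets ?R = sets N"
    using nonempty kernel_space by (intro sets_bind) auto
  have "?Q = ?R"
  proof (rule measure_eqI)
    fix B assume "B \<in> sets ?Q"
    then have [measurable]: "B \<in> sets N" by simp
    have "emeasure ?Q B = (\<integral>\<^sup>+ z. indicator (A \<times> B) z \<partial>P)"
      by (subst emeasure_distr, simp, simp, subst emeasure_density)
         (auto intro!: nn_integral_cong split: split_indicator)
    also have "\<dots> = emeasure P (A \<times> B)"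
    proof (rule nn_integral_indicator)
      have "A \<times> B = (fst -` A \<inter> space P) \<inter> (snd -` B \<inter> space P)"
        using sets.sets_into_space[OF \<open>A \<in> sets M\<close>] sets.sets_into_space[OF \<open>B \<in> sets N\<close>]
        by (auto simp: space_eq)
      then show "A \<times> B \<in> sets P" by simp
    qed
    also have "\<dots> = (\<integral>\<^sup>+ w. indicator A w * emeasure (K w) B \<partial>distr P M fst)"
      by (simp add: emeasure_Times mult.commute)
    also have "\<dots> = emeasure ?R B"
      using nonempty by (subst emeasure_bind[OF _ K]) (auto simp: nn_integral_density)
    finally show "emeasure ?Q B = emeasure ?R B" .
  qed (simp add: sets_R)
  have "(\<integral>\<^sup>+ z. indicator A (fst z) * v (snd z) \<partial>P) = (\<integral>\<^sup>+ c. v c \<partial>?Q)"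
    by (simp add: nn_integral_distr nn_integral_density)
  also have "\<dots> = (\<integral>\<^sup>+ w. \<integral>\<^sup>+ c. v c \<partial>K w \<partial>density (distr P M fst) (indicator A))"
    unfolding \<open>?Q = ?R\<close> by (rule nn_integral_bind[OF v K])
  also have "\<dots> = (\<integral>\<^sup>+ z. indicator A (fst z) * (\<integral>\<^sup>+ c. v c \<partial>K (fst z)) \<partial>P)"
    by (simp add: nn_integral_distr nn_integral_density)
  finally show ?thesis .
qed

lemma bounded_integrable:
  fixes h :: "'a \<times> 'm \<Rightarrow> 'b::{banach, second_countable_topology}"
  assumes "h \<in> borel_measurable P" "\<And>z. z \<in> space P \<Longrightarrow> norm (h z) \<le> B"
  shows "integrable P h"
  by (rule integrable_const_bound[of _ B]) (use assms in \<open>auto intro!: AE_I2\<close>)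

lemma snd_integrable: "integrable P snd"
  by (rule bounded_integrable[of _ b]) (auto simp: space_eq norm_le)

lemma cmean_integrable: "integrable P (\<lambda>z. cmean (fst z))"
  by (rule bounded_integrable[of _ b]) (auto simp: space_eq norm_cmean_le)

text \<open>With \<open>A\<close> ranging over \<open>M\<close>, this is the defining property of a
  conditional expectation, coordinate by coordinate. The disintegration handles nonnegative
  integrands, so each coordinate is shifted by \<open>b\<close>, which bounds its absolute value;
  the shift cancels at the end.\<close>

lemma integral_indicator_inner:
  assumes [measurable]: "A \<in> sets M" and i: "i \<in> Basis"
  shows "(\<integral>z. indicator A (fst z) * (snd z \<bullet> i) \<partial>P)
    = (\<integral>z. indicator A (fst z) * (cmean (fst z) \<bullet> i) \<partial>P)"
proof -
  have ge: "0 \<le> c \<bullet> i + b" if "norm c \<le> b" for c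
    using Basis_le_norm[OF i, of c] that by linarith
  have inner: "(\<integral>\<^sup>+ c. ennreal (c \<bullet> i + b) \<partial>K w) = ennreal (cmean w \<bullet> i + b)" if "w \<in> space M" for w
  proof -
    interpret Kw: prob_space "K w" using kernel_space[OF that] by simp
    have "(\<integral>\<^sup>+ c. ennreal (c \<bullet> i + b) \<partial>K w) = ennreal (\<integral> c. c \<bullet> i + b \<partial>K w)"
      using kernel_integrable[OF that] kernel_space[OF that]
      by (intro nn_integral_eq_integral) (auto intro!: AE_I2 ge norm_le)
    also have "(\<integral> c. c \<bullet> i + b \<partial>K w) = cmean w \<bullet> i + b"
      using kernel_integrable[OF that] by (simp add: cmean_def Kw.prob_space)
    finally show ?thesis .
  qed
  have ind: "integrable P (\<lambda>z. indicator A (fst z) * h z)" if "integrable P h" for h :: "_ \<Rightarrow> real"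
  proof -
    have [measurable]: "h \<in> borel_measurable P"
      using that by (rule borel_measurable_integrable)
    show ?thesis
      using that by (rule Bochner_Integration.integrable_bound) (auto split: split_indicator)
  qed
  have int: "integrable P (\<lambda>z. indicator A (fst z) * (h z \<bullet> i + b))"
    "integrable P (\<lambda>z. indicator A (fst z) * (h z \<bullet> i))"
    "integrable P (\<lambda>z. indicator A (fst z) * b)" if "integrable P h" for h
    by (intro ind; use that in simp)+
  have "ennreal (\<integral>z. indicator A (fst z) * (snd z \<bullet> i + b) \<partial>P)
    = (\<integral>\<^sup>+ z. indicator A (fst z) * ennreal (snd z \<bullet> i + b) \<partial>P)"
    by (subst nn_integral_eq_integral[symmetric, OF int(1)[OF snd_integrable]])
       (auto simp: space_eq norm_le ge ennreal_mult' split: split_indicator intro!: AE_I2 nn_integral_cong)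
  also have "\<dots> = (\<integral>\<^sup>+ z. indicator A (fst z) * (\<integral>\<^sup>+ c. ennreal (c \<bullet> i + b) \<partial>K (fst z)) \<partial>P)"
    by (rule nn_integral_disintegration) auto
  also have "\<dots> = (\<integral>\<^sup>+ z. indicator A (fst z) * ennreal (cmean (fst z) \<bullet> i + b) \<partial>P)"
    by (intro nn_integral_cong) (auto simp: inner space_eq)
  also have "\<dots> = ennreal (\<integral>z. indicator A (fst z) * (cmean (fst z) \<bullet> i + b) \<partial>P)"
    by (subst nn_integral_eq_integral[symmetric, OF int(1)[OF cmean_integrable]])
       (auto simp: space_eq norm_cmean_le ge ennreal_mult' split: split_indicator intro!: AE_I2 nn_integral_cong)
  finally have "(\<integral>z. indicator A (fst z) * (snd z \<bullet> i + b) \<partial>P)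
    = (\<integral>z. indicator A (fst z) * (cmean (fst z) \<bullet> i + b) \<partial>P)"
    by (subst (asm) ennreal_inj)
       (auto intro!: integral_nonneg_AE AE_I2 simp: space_eq norm_le norm_cmean_le ge split: split_indicator)
  then show ?thesis
    using int[OF snd_integrable] int[OF cmean_integrable] by (simp add: distrib_left)
qed

text \<open>In each coordinate the conditional mean is a version of the conditional expectation of
  \<open>c\<close> given the sigma-algebra generated by \<open>w\<close>. A factor depending on
  \<open>w\<close> alone can be pulled out of it, and the coordinates are then summed.\<close>

lemma integral_inner_cmean:
  assumes h [measurable]: "h \<in> borel_measurable M" and int: "integrable P (\<lambda>z. h (fst z))"
  shows "integrable P (\<lambda>z. h (fst z) \<bullet> snd z)"
    and "integrable P (\<lambda>z. h (fst z) \<bullet> cmean (fst z))"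
    and "(\<integral>z. h (fst z) \<bullet> snd z \<partial>P) = (\<integral>z. h (fst z) \<bullet> cmean (fst z) \<partial>P)"
proof -
  let ?F = "vimage_algebra (space P) fst M"
  have fstF: "fst \<in> ?F \<rightarrow>\<^sub>M M"
    by (rule measurable_vimage_algebra1) (auto simp: space_eq)
  have sets_F: "sets ?F = {fst -` A \<inter> space P |A. A \<in> sets M}"
    by (rule sets_vimage_algebra2) (auto simp: space_eq)
  then have "sets ?F \<subseteq> sets P"
    by auto
  then have "subalgebra P ?F"
    by (auto simp: subalgebra_def)
  then interpret finite_measure_subalgebra P ?F
    by unfold_locales
  have int_inner: "integrable P (\<lambda>z. h (fst z) \<bullet> v z)"
    if [measurable]: "v \<in> borel_measurable P" and v: "\<And>z. z \<in> space P \<Longrightarrow> norm (v z) \<le> b" for v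
  proof (rule Bochner_Integration.integrable_bound)
    show "integrable P (\<lambda>z. b * norm (h (fst z)))"
      using int by simp
    have "norm (h (fst z) \<bullet> v z) \<le> norm (b * norm (h (fst z)))" if "z \<in> space P" for z
    proof -
      have "norm (h (fst z) \<bullet> v z) \<le> norm (h (fst z)) * norm (v z)"
        by (simp add: Cauchy_Schwarz_ineq2)
      also have "\<dots> \<le> norm (h (fst z)) * b"
        by (intro mult_left_mono v that) auto
      finally show ?thesis
        using order_trans[OF norm_ge_zero v[OF that]] by (simp add: mult.commute)
    qed
    then show "AE z in P. norm (h (fst z) \<bullet> v z) \<le> norm (b * norm (h (fst z)))"
      by auto
  qed simp
  show 1: "integrable P (\<lambda>z. h (fst z) \<bullet> snd z)"
    by (rule int_inner) (auto simp: space_eq norm_le)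
  show 2: "integrable P (\<lambda>z. h (fst z) \<bullet> cmean (fst z))"
    by (rule int_inner) (auto simp: space_eq norm_cmean_le)
  have comp_int: "integrable P (\<lambda>z. (h (fst z) \<bullet> i) * (v z \<bullet> i))"
    if [measurable]: "v \<in> borel_measurable P" and v: "\<And>z. z \<in> space P \<Longrightarrow> norm (v z) \<le> b"
      and i: "i \<in> Basis" for v i
  proof -
    \<comment> \<open>The product of two coordinates is the inner product of \<open>h\<close> with
      the projection of \<open>v\<close> onto \<open>i\<close>, which is still bounded by
      \<open>b\<close>; this reduces the claim to \<open>int_inner\<close>.\<close>
    have "norm ((v z \<bullet> i) *\<^sub>R i) \<le> b" if "z \<in> space P" for z
      using v[OF that] Basis_le_norm[OF i, of "v z"] i by simp
    then have "integrable P (\<lambda>z. h (fst z) \<bullet> ((v z \<bullet> i) *\<^sub>R i))"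
      by (intro int_inner) auto
    then show ?thesis by (simp add: mult.commute)
  qed
  have comp: "(\<integral>z. (h (fst z) \<bullet> i) * (snd z \<bullet> i) \<partial>P) = (\<integral>z. (h (fst z) \<bullet> i) * (cmean (fst z) \<bullet> i) \<partial>P)"
    if i: "i \<in> Basis" for i
  proof -
    have ae: "AE z in P. real_cond_exp P ?F (\<lambda>z. snd z \<bullet> i) z = cmean (fst z) \<bullet> i"
    proof (rule real_cond_exp_charact)
      fix A assume "A \<in> sets ?F"
      then obtain A' where A': "A' \<in> sets M" "A = fst -` A' \<inter> space P"
        by (auto simp: sets_F)
      have "(\<integral>z. indicator A z * u z \<partial>P) = (\<integral>z. indicator A' (fst z) * u z \<partial>P)" for u :: "_ \<Rightarrow> real"
        by (rule Bochner_Integration.integral_cong) (auto simp: A' split: split_indicator)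
      then show "(\<integral>z\<in>A. snd z \<bullet> i \<partial>P) = (\<integral>z\<in>A. cmean (fst z) \<bullet> i \<partial>P)"
        using integral_indicator_inner[OF A'(1) i] by (simp add: set_lebesgue_integral_def)
    next
      show "(\<lambda>z. cmean (fst z) \<bullet> i) \<in> borel_measurable ?F"
        using measurable_compose[OF fstF cmean_measurable] by simp
    qed (use snd_integrable cmean_integrable in auto)
    \<comment> \<open>The factor \<open>h (fst z) \<bullet> i\<close> is measurable for
      \<open>?F\<close>, so the other factor may be replaced by its conditional expectation.\<close>
    have "(\<integral>z. (h (fst z) \<bullet> i) * (snd z \<bullet> i) \<partial>P)
      = (\<integral>z. (h (fst z) \<bullet> i) * real_cond_exp P ?F (\<lambda>z. snd z \<bullet> i) z \<partial>P)"
    proof (rule real_cond_exp_intg(2)[symmetric])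
      show "integrable P (\<lambda>z. (h (fst z) \<bullet> i) * (snd z \<bullet> i))"
        by (rule comp_int) (auto simp: i space_eq norm_le)
      show "(\<lambda>z. h (fst z) \<bullet> i) \<in> borel_measurable ?F"
        using measurable_compose[OF fstF h] by simp
    qed simp
    also have "\<dots> = (\<integral>z. (h (fst z) \<bullet> i) * (cmean (fst z) \<bullet> i) \<partial>P)"
      using ae by (intro integral_cong_AE) (auto intro: measurable_from_subalg[OF subalg])
    finally show ?thesis .
  qed
  have "(\<integral>z. h (fst z) \<bullet> snd z \<partial>P) = (\<Sum>i\<in>Basis. \<integral>z. (h (fst z) \<bullet> i) * (snd z \<bullet> i) \<partial>P)"
    by (subst euclidean_inner, rule Bochner_Integration.integral_sum, rule comp_int)
       (auto simp: space_eq norm_le)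
  also have "\<dots> = (\<Sum>i\<in>Basis. \<integral>z. (h (fst z) \<bullet> i) * (cmean (fst z) \<bullet> i) \<partial>P)"
    by (intro sum.cong comp) auto
  also have "\<dots> = (\<integral>z. h (fst z) \<bullet> cmean (fst z) \<partial>P)"
    by (subst euclidean_inner, rule Bochner_Integration.integral_sum[symmetric], rule comp_int)
       (auto simp: space_eq norm_cmean_le)
  finally show "(\<integral>z. h (fst z) \<bullet> snd z \<partial>P) = (\<integral>z. h (fst z) \<bullet> cmean (fst z) \<partial>P)" .
qed

section \<open>Squared risk and its excess over the conditional mean\<close>

lemma risk_eq_integral:
  assumes "integrable P (\<lambda>z. l (g (fst z)) (snd z))" "\<And>d c. 0 \<le> l d c"
  shows "risk l P g = ereal (\<integral>z. l (g (fst z)) (snd z) \<partial>P)"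
  using assms by (simp add: risk_def nn_integral_eq_integral integral_nonneg_AE)

text \<open>Expanding the square around the conditional mean leaves a cross term, the inner product
  of a function of \<open>w\<close> with \<open>cmean w - c\<close>; its integral vanishes by
  \<open>integral_inner_cmean\<close>. Finite risk of \<open>g\<close> makes the other terms
  integrable.\<close>

lemma squared_risk_decomposition:
  assumes [measurable]: "g \<in> borel_measurable M" and fin: "risk squared_loss P g < \<infinity>"
  shows "integrable P (\<lambda>z. (norm (g (fst z) - cmean (fst z)))\<^sup>2)"
    and "risk squared_loss P g =
      risk squared_loss P cmean + ereal (\<integral>z. (norm (g (fst z) - cmean (fst z)))\<^sup>2 \<partial>P)"
    and "\<bar>risk squared_loss P cmean\<bar> \<noteq> \<infinity>"
proof -
  let ?u = "\<lambda>z. g (fst z) - cmean (fst z)"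
  have int_g: "integrable P (\<lambda>z. (norm (g (fst z) - snd z))\<^sup>2)"
    using fin by (intro integrableI_bounded) (auto simp: risk_def squared_loss_def less_top)
  have dist_le: "norm (cmean (fst z) - snd z) \<le> 2 * b" if "z \<in> space P" for z
    using norm_triangle_ineq4[of "cmean (fst z)" "snd z"] norm_cmean_le[of "fst z"] norm_le[of "snd z"] that
    by (auto simp: space_eq)
  have int_c: "integrable P (\<lambda>z. (norm (cmean (fst z) - snd z))\<^sup>2)"
    using dist_le[THEN power_mono[of _ _ 2]]
    by (intro bounded_integrable[of _ "(2 * b)\<^sup>2"]) (auto simp del: split_paired_All)
  show int_u: "integrable P (\<lambda>z. (norm (?u z))\<^sup>2)"
  proof (rule Bochner_Integration.integrable_bound)
    show "integrable P (\<lambda>z. 2 * (norm (g (fst z) - snd z))\<^sup>2 + 2 * (norm (cmean (fst z) - snd z))\<^sup>2)"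
      using int_g int_c by simp
    have "(norm (?u z))\<^sup>2 \<le> 2 * (norm (g (fst z) - snd z))\<^sup>2 + 2 * (norm (cmean (fst z) - snd z))\<^sup>2" for z
    proof -
      have "norm (?u z) \<le> norm (g (fst z) - snd z) + norm (cmean (fst z) - snd z)"
        using norm_triangle_ineq4[of "g (fst z) - snd z" "cmean (fst z) - snd z"] by simp
      then have "(norm (?u z))\<^sup>2 \<le> (norm (g (fst z) - snd z) + norm (cmean (fst z) - snd z))\<^sup>2"
        by (intro power_mono) auto
      also have "\<dots> \<le> 2 * (norm (g (fst z) - snd z))\<^sup>2 + 2 * (norm (cmean (fst z) - snd z))\<^sup>2"
        using sum_squares_bound[of "norm (g (fst z) - snd z)" "norm (cmean (fst z) - snd z)"]
        by (simp add: power2_sum)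
      finally show ?thesis .
    qed
    then show "AE z in P. norm ((norm (?u z))\<^sup>2)
        \<le> norm (2 * (norm (g (fst z) - snd z))\<^sup>2 + 2 * (norm (cmean (fst z) - snd z))\<^sup>2)"
      by auto
  qed simp
  \<comment> \<open>Square integrability passes to integrability through
    \<open>t \<le> 1 + t\<^sup>2\<close>.\<close>
  have "integrable P ?u"
  proof (rule Bochner_Integration.integrable_bound)
    show "integrable P (\<lambda>z. 1 + (norm (?u z))\<^sup>2)"
      using int_u by simp
    have "norm (?u z) \<le> 1 + (norm (?u z))\<^sup>2" for z
      using sum_squares_bound[of 1 "norm (?u z)"] norm_ge_zero[of "?u z"]
      unfolding mult_1_right power_one by linarith
    then show "AE z in P. norm (?u z) \<le> norm (1 + (norm (?u z))\<^sup>2)"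
      by auto
  qed simp
  then have cross: "integrable P (\<lambda>z. ?u z \<bullet> snd z)" "integrable P (\<lambda>z. ?u z \<bullet> cmean (fst z))"
      "(\<integral>z. ?u z \<bullet> snd z \<partial>P) = (\<integral>z. ?u z \<bullet> cmean (fst z) \<partial>P)"
    using integral_inner_cmean[of "\<lambda>w. g w - cmean w"] by auto
  have risk_c: "risk squared_loss P cmean = ereal (\<integral>z. (norm (cmean (fst z) - snd z))\<^sup>2 \<partial>P)"
    using int_c by (subst risk_eq_integral) (auto simp: squared_loss_def)
  then show "\<bar>risk squared_loss P cmean\<bar> \<noteq> \<infinity>" by simp
  have "(\<integral>z. (norm (g (fst z) - snd z))\<^sup>2 \<partial>P)
    = (\<integral>z. (norm (cmean (fst z) - snd z))\<^sup>2 + (norm (?u z))\<^sup>2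
        + 2 * (?u z \<bullet> cmean (fst z) - ?u z \<bullet> snd z) \<partial>P)"
    by (intro Bochner_Integration.integral_cong refl)
       (simp add: power2_norm_eq_inner algebra_simps inner_commute)
  also have "\<dots> = (\<integral>z. (norm (cmean (fst z) - snd z))\<^sup>2 \<partial>P) + (\<integral>z. (norm (?u z))\<^sup>2 \<partial>P)"
    using int_c int_u cross by simp
  finally show "risk squared_loss P g = risk squared_loss P cmean + ereal (\<integral>z. (norm (?u z))\<^sup>2 \<partial>P)"
    using int_g by (subst risk_eq_integral) (auto simp: squared_loss_def risk_c)
qed

end

section \<open>Comparison of the two excess risks\<close>

locale predict_then_optimize = argmin_oracle X f xs + disintegration P M N K b
  for X :: "'m::euclidean_space set" and f xs and P :: "('a \<times> 'm) measure" and M N K b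
begin

text \<open>With \<open>d = h w\<close> and \<open>m = cmean w\<close>, the loss at \<open>c\<close>
  is the loss at \<open>m\<close>, plus \<open>opt_value m - opt_value c\<close>, plus
  \<open>xs d \<bullet> (c - m)\<close>. The last term integrates to zero, since \<open>xs d\<close>
  is a bounded function of \<open>w\<close>; the middle one does not depend on
  \<open>h\<close>.\<close>

lemma true_risk_eq:
  assumes D [measurable]: "(\<lambda>w. xs (h w)) \<in> borel_measurable M"
  shows "integrable P (\<lambda>z. true_loss X f xs (h (fst z)) (cmean (fst z)))"
    and "risk (true_loss X f xs) P h =
      ereal ((\<integral>z. true_loss X f xs (h (fst z)) (cmean (fst z)) \<partial>P)
        + (\<integral>z. opt_value (cmean (fst z)) - opt_value (snd z) \<partial>P))"
proof -
  note [measurable] = objective_measurable[OF D] opt_value_measurable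
  obtain B where B: "\<And>d c. norm c \<le> b \<Longrightarrow> \<bar>f (xs d) + c \<bullet> xs d\<bar> \<le> B"
    using cost_bounded[of b] by blast
  \<comment> \<open>The optimal value is the cost of the decision \<open>xs c\<close>, so it obeys
    the same bound \<open>B\<close>; the loss is a difference of two such costs.\<close>
  have bound: "\<bar>true_loss X f xs d c\<bar> \<le> 2 * B" "\<bar>opt_value c\<bar> \<le> B" if "norm c \<le> b" for d c
    using B[OF that, of d] B[OF that, of c] by (auto simp: true_loss_eq opt_value_eq)
  have int_opt: "integrable P (\<lambda>z. opt_value (cmean (fst z)))" "integrable P (\<lambda>z. opt_value (snd z))"
    by (intro bounded_integrable[of _ B]; auto simp: space_eq norm_le norm_cmean_le bound)+
  have "integrable P (\<lambda>z. xs (h (fst z)))"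
  proof -
    obtain B' where "\<And>x. x \<in> X \<Longrightarrow> norm x \<le> B'"
      using bounded_feasible by (auto simp: bounded_iff)
    then show ?thesis
      by (intro bounded_integrable[of _ B']) (auto simp: xs_feasible)
  qed
  note cross = integral_inner_cmean[OF D this]
  show int_cmean: "integrable P (\<lambda>z. true_loss X f xs (h (fst z)) (cmean (fst z)))"
    by (rule bounded_integrable[of _ "2 * B"])
       (auto simp: space_eq norm_cmean_le bound, simp add: true_loss_eq)
  have int_snd: "integrable P (\<lambda>z. true_loss X f xs (h (fst z)) (snd z))"
    by (rule bounded_integrable[of _ "2 * B"])
       (auto simp: space_eq norm_le bound, simp add: true_loss_eq)
  have "(\<integral>z. true_loss X f xs (h (fst z)) (snd z) \<partial>P)
    = (\<integral>z. true_loss X f xs (h (fst z)) (cmean (fst z))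
        + (opt_value (cmean (fst z)) - opt_value (snd z))
        + (xs (h (fst z)) \<bullet> snd z - xs (h (fst z)) \<bullet> cmean (fst z)) \<partial>P)"
    by (intro Bochner_Integration.integral_cong refl) (simp add: true_loss_eq inner_commute)
  also have "\<dots> = (\<integral>z. true_loss X f xs (h (fst z)) (cmean (fst z)) \<partial>P)
        + (\<integral>z. opt_value (cmean (fst z)) - opt_value (snd z) \<partial>P)"
    using int_cmean int_opt cross by simp
  finally show "risk (true_loss X f xs) P h =
      ereal ((\<integral>z. true_loss X f xs (h (fst z)) (cmean (fst z)) \<partial>P)
        + (\<integral>z. opt_value (cmean (fst z)) - opt_value (snd z) \<partial>P))"
    using int_snd by (subst risk_eq_integral) (auto simp: true_loss_nonneg)
qed

text \<open>The conditional mean need not belong to \<open>G\<close>, since \<open>xs\<close> composed with it may fail to be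
  measurable. The lower bound on the minimal true risk therefore uses \<open>opt_value\<close>
  instead of the risk of the conditional mean.\<close>

lemma excess_true_risk_bounds:
  assumes G: "\<And>h. h \<in> G \<Longrightarrow> (\<lambda>w. xs (h w)) \<in> borel_measurable M" and g: "g \<in> G"
  obtains r where "risk (true_loss X f xs) P g - min_risk (true_loss X f xs) P G = ereal r"
    and "0 \<le> r" and "r \<le> (\<integral>z. true_loss X f xs (g (fst z)) (cmean (fst z)) \<partial>P)"
proof -
  let ?J = "\<integral>z. opt_value (cmean (fst z)) - opt_value (snd z) \<partial>P"
  have lower: "ereal ?J \<le> min_risk (true_loss X f xs) P G"
    unfolding min_risk_def
    by (rule INF_greatest) (simp add: true_risk_eq(2) G true_loss_nonneg)
  have upper: "min_risk (true_loss X f xs) P G \<le> risk (true_loss X f xs) P g"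
    unfolding min_risk_def by (rule INF_lower[OF g])
  note risk_g = true_risk_eq(2)[OF G[OF g]]
  \<comment> \<open>The infimum lies between two finite values, so the difference below is one of
    real numbers.\<close>
  obtain m where m: "min_risk (true_loss X f xs) P G = ereal m"
    using lower upper unfolding risk_g by (cases "min_risk (true_loss X f xs) P G") auto
  show thesis
    using lower upper by (intro that) (auto simp: risk_g m)
qed

text \<open>The two infima range over separate families: \<open>G\<close> has measurable decisions,
  which gives the true risk its meaning, while \<open>H\<close> has to contain the conditional mean
  as a competitor for the squared risk.\<close>

lemma excess_risk_bound:
  assumes G: "\<And>h. h \<in> G \<Longrightarrow> (\<lambda>w. xs (h w)) \<in> borel_measurable M" and g: "g \<in> G"
    and [measurable]: "g \<in> borel_measurable M" and H: "cmean \<in> H"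
  shows "ereal (1 / (diameter X)\<^sup>2) *
      (risk (true_loss X f xs) P g - min_risk (true_loss X f xs) P G)\<^sup>2
    \<le> risk squared_loss P g - min_risk squared_loss P H"
proof -
  have min_le: "min_risk squared_loss P H \<le> risk squared_loss P cmean"
    unfolding min_risk_def by (rule INF_lower[OF H])
  have cmean_fin: "\<bar>risk squared_loss P cmean\<bar> \<noteq> \<infinity>"
  proof (rule squared_risk_decomposition(3))
    \<comment> \<open>The zero predictor supplies a finite squared risk, the second moment of
      \<open>c\<close>.\<close>
    show "(\<lambda>w. 0) \<in> borel_measurable M" by simp
    have "integrable P (\<lambda>z. (norm (snd z))\<^sup>2)"
      by (rule bounded_integrable[of _ "b\<^sup>2"]) (auto simp: space_eq norm_le intro: power_mono)
    then show "risk squared_loss P (\<lambda>w. 0) < \<infinity>"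
      by (subst risk_eq_integral) (auto simp: squared_loss_def)
  qed
  show ?thesis
  proof (cases "risk squared_loss P g < \<infinity>")
    case False
    \<comment> \<open>The subtracted infimum is at most the finite risk of \<open>cmean\<close>, so
      the form infinity minus infinity does not arise.\<close>
    then have "risk squared_loss P g - min_risk squared_loss P H = \<infinity>"
      using min_le cmean_fin by auto
    then show ?thesis by simp
  next
    case True
    let ?u = "\<lambda>z. g (fst z) - cmean (fst z)"
    let ?T = "\<lambda>z. true_loss X f xs (g (fst z)) (cmean (fst z))"
    let ?E = "\<integral>z. (norm (?u z))\<^sup>2 \<partial>P"
    note sq = squared_risk_decomposition[OF \<open>g \<in> borel_measurable M\<close> True]
    obtain r where r: "risk (true_loss X f xs) P g - min_risk (true_loss X f xs) P G = ereal r"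
      and "0 \<le> r" and r_le: "r \<le> (\<integral>z. ?T z \<partial>P)"
      using excess_true_risk_bounds[OF G g] by blast
    have int_T: "integrable P ?T"
      by (rule true_risk_eq(1)[OF G[OF g]])
    have T_sq: "(?T z)\<^sup>2 \<le> (diameter X)\<^sup>2 * (norm (?u z))\<^sup>2" for z
      using power_mono[OF true_loss_le true_loss_nonneg, of "g (fst z)" "cmean (fst z)" 2]
      by (simp add: power_mult_distrib)
    have int_T_sq: "integrable P (\<lambda>z. (?T z)\<^sup>2)"
    proof (rule Bochner_Integration.integrable_bound)
      show "integrable P (\<lambda>z. (diameter X)\<^sup>2 * (norm (?u z))\<^sup>2)"
        using sq(1) by simp
      show "(\<lambda>z. (?T z)\<^sup>2) \<in> borel_measurable P"
        using borel_measurable_integrable[OF int_T] by simp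
    qed (use T_sq in auto)
    have "r\<^sup>2 \<le> (\<integral>z. ?T z \<partial>P)\<^sup>2"
      using r_le \<open>0 \<le> r\<close> by (rule power_mono)
    \<comment> \<open>Jensen's inequality for the square, read as nonnegativity of the
      variance.\<close>
    also have "\<dots> \<le> (\<integral>z. (?T z)\<^sup>2 \<partial>P)"
      using variance_positive[of ?T] variance_eq[OF int_T int_T_sq] by simp
    also have "\<dots> \<le> (\<integral>z. (diameter X)\<^sup>2 * (norm (?u z))\<^sup>2 \<partial>P)"
      using int_T_sq sq(1) T_sq by (intro integral_mono) auto
    also have "\<dots> = (diameter X)\<^sup>2 * ?E" by simp
    \<comment> \<open>If the diameter is 0, then \<open>1 / 0 = 0\<close> makes the left side 0, and
      the right side is nonnegative.\<close>
    finally have "1 / (diameter X)\<^sup>2 * r\<^sup>2 \<le> ?E"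
      by (cases "diameter X = 0") (auto simp: field_simps)
    then have "ereal (1 / (diameter X)\<^sup>2) *
        (risk (true_loss X f xs) P g - min_risk (true_loss X f xs) P G)\<^sup>2 \<le> ereal ?E"
      by (simp add: r)
    also have "\<dots> = risk squared_loss P g - risk squared_loss P cmean"
      unfolding sq(2) using cmean_fin by (cases "risk squared_loss P cmean") auto
    also have "\<dots> \<le> risk squared_loss P g - min_risk squared_loss P H"
      using min_le by (rule ereal_minus_mono[OF order_refl])
    finally show ?thesis .
  qed
qed

end

section \<open>Specialization to Lebesgue measurable distributions\<close>

theorem corollary3:
  fixes X :: "(real ^ 'm) set" and f :: "real ^ 'm \<Rightarrow> real"
    and xs :: "real ^ 'm \<Rightarrow> real ^ 'm"
    and W :: "(real ^ 'k) set" and C :: "(real ^ 'm) set"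
    and P :: "((real ^ 'k) \<times> (real ^ 'm)) measure" and g :: "real ^ 'k \<Rightarrow> real ^ 'm"
  assumes "X \<noteq> {}" and "convex X" and "compact X"
    and "convex_on X f" and "continuous_on X f"
    and "\<And>d. xs d \<in> argmin_set X f d"
    and "bounded C"
    and "P \<in> distribution_class W C"
    and "g \<in> decision_predictors W xs"
  shows "ereal (1 / (diameter X)\<^sup>2) *
           (risk (true_loss X f xs) P g
             - min_risk (true_loss X f xs) P (decision_predictors W xs))\<^sup>2
         \<le> risk squared_loss P g - min_risk squared_loss P (predictors W)"
proof -
  obtain K where P: "prob_space P" "sets P = sets (lebesgue_on (W \<times> C))"
    and K: "conditional_distribution W C P K"
    using assms(8) by (auto simp: distribution_class_def distributions_def)
  obtain b where b: "\<And>c. c \<in> C \<Longrightarrow> norm c \<le> b"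
    using assms(7) by (auto simp: bounded_iff)
  have cong: "P \<rightarrow>\<^sub>M N = lebesgue_on (W \<times> C) \<rightarrow>\<^sub>M N" for N :: "'z measure"
    by (rule measurable_cong_sets[OF P(2) refl])
  interpret prob_space P by (rule P(1))
  interpret predict_then_optimize X f xs P "lebesgue_on W" "lebesgue_on C" K b
  proof
    show "space P = space (lebesgue_on W) \<times> space (lebesgue_on C)"
      using sets_eq_imp_space_eq[OF P(2)] by (simp add: space_restrict_space)
    show "fst \<in> P \<rightarrow>\<^sub>M lebesgue_on W" "snd \<in> P \<rightarrow>\<^sub>M lebesgue_on C"
      unfolding cong by (rule fst_measurable_lebesgue_on snd_measurable_lebesgue_on)+
    \<comment> \<open>Borel measurability of the identity survives completion and restriction to
      \<open>C\<close>.\<close>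
    show "(\<lambda>c. c) \<in> borel_measurable (lebesgue_on C)"
      by (intro measurable_restrict_space1 measurable_completion) simp
  qed (use assms(3,5,6) K b in \<open>auto simp: conditional_distribution_def space_restrict_space\<close>)
  show ?thesis
    \<comment> \<open>Here \<open>G\<close> is \<open>decision_predictors W xs\<close> and
      \<open>H\<close> is \<open>predictors W\<close>, to which \<open>cmean\<close> belongs by
      \<open>cmean_measurable\<close>.\<close>
    using assms(9) by (intro excess_risk_bound) (auto simp: decision_predictors_def)
qed

end
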